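(* For every $n\in\mathbb{N}$ ($n\ge 1$), $$\sqrt{n}\le\theta_n(B_n)\le\sqrt{n+1}.$$ Moreover, $\theta_n(B_n)=\sqrt{n}$ only for $n=1$ (that is, equality holds if and only if $n=1$), and $\theta_n(B_n)=\sqrt{n+1}$ if and only if $\sqrt{n+1}$ is an integer.
   Context: $B_n=\{x\in\mathbb{R}^n:\|x\|\le 1\}$ is the closed Euclidean unit ball, where $\|\cdot\|$ is the Euclidean norm. $C(B_n)$ is the space of continuous functions $f:B_n\to\mathbb{R}$ with the uniform norm $\|f\|_{C(B_n)}=\max_{x\in B_n}|f(x)|$. $\Pi_1(\mathbb{R}^n)$ is the set of real polynomials in $n$ variables of degree $\le 1$ (i.e. affine functions on $\mathbb{R}^n$). Let $S\subset B_n$ be a nondegenerate $n$-dimensional simplex with vertices $x^{(1)},\dots,x^{(n+1)}$. The interpolation projector $P:C(B_n)\to\Pi_1(\mathbb{R}^n)$ with nodes $x^{(1)},\dots,x^{(n+1)}$ is the linear operator defined by $Pf\in\Pi_1(\mathbb{R}^n)$ and $Pf(x^{(j)})=f(x^{(j)})$ for $1\le j\le n+1$. Equivalently, $Pf(x)=\sum_{j=1}^{n+1}f(x^{(j)})\lambda_j(x)$, where $\lambda_j\in\Pi_1(\mathbb{R}^n)$ are determined by $\lambda_j(x^{(k)})=\delta_j^k$ (the barycentric coordinates with respect to $S$). $\|P\|_{B_n}$ denotes the norm of $P$ as an operator from $C(B_n)$ to $C(B_n)$ (with $Pf$ restricted to $B_n$); it equals $\max_{x\in B_n}\sum_{j=1}^{n+1}|\lambda_j(x)|$.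 $\theta_n(B_n)$ denotes the minimal value of $\|P\|_{B_n}$ over all interpolation projectors $P:C(B_n)\to\Pi_1(\mathbb{R}^n)$ whose nodes belong to $B_n$ and are the vertices of a nondegenerate simplex. *)

theory Defs
  imports "HOL-Analysis.Analysis"
begin

text \<open>The space $C(K)$ over a set $K$ in $R^n$ is represented by total functions that are
  continuous on $K$; values outside $K$ play no role.\<close>

definition cont_fun :: "(real ^ 'n) set \<Rightarrow> (real ^ 'n \<Rightarrow> real) set" where
  "cont_fun K = {f. continuous_on K f}"

text \<open>For continuous functions on nonempty compact $K$ the supremum is a maximum.\<close>

definition unif_norm :: "(real ^ 'n) set \<Rightarrow> (real ^ 'n \<Rightarrow> real) \<Rightarrow> real" where
  "unif_norm K f = (SUP x\<in>K. \<bar>f x\<bar>)"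

definition poly_deg_le_1 :: "(real ^ 'n \<Rightarrow> real) set" where
  "poly_deg_le_1 = {p. \<exists>c a. \<forall>x. p x = c + (\<Sum>i\<in>UNIV. a i * x $ i)}"

definition simplex_vertices :: "(real ^ 'n) set \<Rightarrow> bool" where
  "simplex_vertices V \<longleftrightarrow> finite V \<and> card V = CARD('n) + 1 \<and> \<not> affine_dependent V"

text \<open>The conditions determine \<open>P f\<close> uniquely for each \<open>f\<close> in $C(K)$ when \<open>V \<subseteq> K\<close> is the vertex
  set of a nondegenerate simplex; in particular \<open>P\<close> is then linear on $C(K)$.\<close>

definition interpolation_projector ::
    "(real ^ 'n) set \<Rightarrow> (real ^ 'n) set \<Rightarrow> ((real ^ 'n \<Rightarrow> real) \<Rightarrow> (real ^ 'n \<Rightarrow> real)) \<Rightarrow> bool" where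
  "interpolation_projector K V P \<longleftrightarrow>
     V \<subseteq> K \<and> simplex_vertices V \<and>
     (\<forall>f\<in>cont_fun K. P f \<in> poly_deg_le_1 \<and> (\<forall>v\<in>V. P f v = f v))"

definition projector_norm ::
    "(real ^ 'n) set \<Rightarrow> ((real ^ 'n \<Rightarrow> real) \<Rightarrow> (real ^ 'n \<Rightarrow> real)) \<Rightarrow> real" where
  "projector_norm K P = (SUP f\<in>{f\<in>cont_fun K. unif_norm K f \<le> 1}. unif_norm K (P f))"

text \<open>For the unit ball the infimum is over a nonempty set of nonnegative reals and is a minimum:
  the norms tend to infinity as a simplex in the ball degenerates, and depend continuously on the
  vertices otherwise.\<close>

definition theta :: "(real ^ 'n) set \<Rightarrow> real" where
  "theta K = Inf {projector_norm K P | P V. interpolation_projector K V P}"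

end

theory Submission
  imports Defs
begin

text \<open>
  If weights \<open>w\<close> on the \<open>n + 1\<close> vertices satisfy \<open>\<Sum>w = 1\<close> and \<open>\<Sum>w\<^sup>2 = 1\<close>, then averaging over all
  permutations \<open>p\<close> of the vertices makes the cross terms of \<open>\<parallel>\<Sum>v. w (p v) v\<parallel>\<^sup>2\<close> vanish, so some point
  with permuted barycentric coordinates \<open>w\<close> lies in the unit ball, and the projector norm is at
  least \<open>\<Sum>\<bar>w\<bar>\<close>. Choosing \<open>w\<close> with two values, one of them on \<open>k\<close> vertices, gives the lower bound
  \<open>sqrt (n (1 - c\<^sup>2)) + c\<close> with \<open>c = 1 - 2 k / (n + 1)\<close>. For the inscribed regular simplex the norm
  is at most the maximum of these numbers over \<open>k\<close>. By Cauchy-Schwarz each is at most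
  \<open>sqrt (n + 1)\<close>, with equality only for \<open>c = 1 / sqrt (n + 1)\<close>, which has the required form exactly
  when \<open>sqrt (n + 1)\<close> is an integer.
\<close>

section \<open>Weights on the vertices and their permutations\<close>

text \<open>If every permutation failed, the squared norms would sum to more than
  \<open>card Q\<close>. The off-diagonal \<open>D u v\<close> vanish, however, and the diagonal
  terms add up to at most \<open>card Q\<close>.\<close>

lemma exists_permutation_norm_le_1:
  fixes w :: "'a::real_inner \<Rightarrow> real"
  assumes fin: "finite V" and w1: "sum w V = 1" and w2: "(\<Sum>v\<in>V. (w v)\<^sup>2) = 1"
    and V1: "\<And>v. v \<in> V \<Longrightarrow> norm v \<le> 1"
  shows "\<exists>p. p permutes V \<and> norm (\<Sum>v\<in>V. w (p v) *\<^sub>R v) \<le> 1"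
proof (rule ccontr)
  define Q where "Q = {p. p permutes V}"
  define D where "D u v = (\<Sum>p\<in>Q. w (p u) * w (p v))" for u v
  assume "\<not> ?thesis"
  then have big: "1 < norm (\<Sum>v\<in>V. w (p v) *\<^sub>R v)" if "p \<in> Q" for p
    using that by (auto simp: Q_def not_le)
  have finQ: "finite Q" using fin by (simp add: Q_def finite_permutations)
  have Qne: "Q \<noteq> {}" using permutes_id[of V] unfolding Q_def by blast
  have perm_sum: "(\<Sum>v\<in>V. h (p v)) = (\<Sum>v\<in>V. h v)" if "p \<in> Q" for p and h :: "'a \<Rightarrow> real"
    using that sum.permute[of p V h] by (simp add: Q_def comp_def)
  have reindex: "(\<Sum>p\<in>Q. h p) = (\<Sum>p\<in>Q. h (p \<circ> q))" if "q permutes V" for q and h :: "_ \<Rightarrow> real"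
    using sum_permutations_compose_right[OF that, of h] by (simp add: Q_def)
  \<comment> \<open>Composition with the transposition of \<open>u\<close> and \<open>v\<close> maps
    \<open>Q\<close> onto itself, so the sum of \<open>h (p v)\<close> over \<open>Q\<close> is the
    same for every vertex \<open>v\<close>.\<close>
  have mean: "real (card V) * (\<Sum>p\<in>Q. h (p u)) = real (card Q) * (\<Sum>v\<in>V. h v)"
    if u: "u \<in> V" for u and h :: "'a \<Rightarrow> real"
  proof -
    have "(\<Sum>p\<in>Q. h (p v)) = (\<Sum>p\<in>Q. h (p u))" if "v \<in> V" for v
      using reindex[OF permutes_swap_id[OF u that], of "\<lambda>p. h (p v)"] by simp
    then have "real (card V) * (\<Sum>p\<in>Q. h (p u)) = (\<Sum>v\<in>V. \<Sum>p\<in>Q. h (p v))" by simp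
    also have "\<dots> = (\<Sum>p\<in>Q. \<Sum>v\<in>V. h (p v))" by (rule sum.swap)
    also have "\<dots> = real (card Q) * (\<Sum>v\<in>V. h v)" by (simp add: perm_sum)
    finally show ?thesis .
  qed
  \<comment> \<open>The \<open>D u z\<close> with \<open>z \<noteq> u\<close> all agree, and their sum vanishes because the mean of \<open>w\<close> equals that of \<open>w\<^sup>2\<close>.\<close>
  have D0: "D u v = 0" if u: "u \<in> V" and v: "v \<in> V" and uv: "u \<noteq> v" for u v
  proof -
    have "D u z = D u v" if "z \<in> V - {u}" for z
      using reindex[OF permutes_swap_id[of z V v], of "\<lambda>p. w (p u) * w (p z)"] that uv v
      by (auto simp: D_def transpose_def)
    then have "real (card (V - {u})) * D u v = (\<Sum>z\<in>V - {u}. D u z)" by simp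
    also have "\<dots> = (\<Sum>z\<in>V. D u z) - D u u" using fin u by (simp add: sum_diff1)
    also have "(\<Sum>z\<in>V. D u z) = (\<Sum>p\<in>Q. \<Sum>z\<in>V. w (p u) * w (p z))"
      unfolding D_def by (rule sum.swap)
    also have "\<dots> = (\<Sum>p\<in>Q. w (p u))"
      using w1 by (simp add: sum_distrib_left[symmetric] perm_sum)
    also have "\<dots> = D u u"
    proof -
      have "real (card V) * (\<Sum>p\<in>Q. w (p u)) = real (card V) * D u u"
        using mean[OF u, of w] mean[OF u, of "\<lambda>z. (w z)\<^sup>2"] w1 w2
        by (simp add: D_def power2_eq_square)
      then show ?thesis using fin u by auto
    qed
    finally have "real (card (V - {u})) * D u v = 0" by simp
    moreover have "card (V - {u}) \<noteq> 0" using fin v uv by auto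
    ultimately show ?thesis by simp
  qed
  have "real (card Q) = (\<Sum>p\<in>Q. 1)" by simp
  also have "\<dots> < (\<Sum>p\<in>Q. (norm (\<Sum>v\<in>V. w (p v) *\<^sub>R v))\<^sup>2)"
    using finQ Qne big by (intro sum_strict_mono) (auto simp: one_less_power)
  also have "\<dots> = (\<Sum>p\<in>Q. \<Sum>u\<in>V. \<Sum>v\<in>V. (w (p u) * w (p v)) * (u \<bullet> v))"
    by (simp add: power2_norm_eq_inner inner_sum_left inner_sum_right mult.assoc)
       (simp add: sum_distrib_left inner_commute mult.left_commute)
  also have "\<dots> = (\<Sum>u\<in>V. \<Sum>v\<in>V. \<Sum>p\<in>Q. (w (p u) * w (p v)) * (u \<bullet> v))"
    by (subst sum.swap, rule sum.cong[OF refl], rule sum.swap)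
  also have "\<dots> = (\<Sum>u\<in>V. \<Sum>v\<in>V. D u v * (u \<bullet> v))"
    by (simp add: D_def sum_distrib_right)
  also have "\<dots> = (\<Sum>u\<in>V. \<Sum>v\<in>V. if u = v then D u u * (u \<bullet> u) else 0)"
    using D0 by (intro sum.cong) auto
  also have "\<dots> = (\<Sum>u\<in>V. D u u * (u \<bullet> u))" using fin by simp
  also have "\<dots> \<le> (\<Sum>u\<in>V. D u u * 1)"
    using V1 by (intro sum_mono mult_left_mono)
      (auto simp: D_def sum_nonneg power2_norm_eq_inner[symmetric] power_le_one)
  also have "\<dots> = (\<Sum>p\<in>Q. \<Sum>u\<in>V. (w (p u))\<^sup>2)"
    unfolding D_def power2_eq_square by (simp add: sum.swap[of _ Q])
  also have "\<dots> = real (card Q)" using w2 by (simp add: perm_sum[of _ "\<lambda>z. (w z)\<^sup>2"])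
  finally show False by simp
qed

text \<open>The weights are \<open>a * e v + b\<close>, where \<open>e\<close> is \<open>-1\<close>
  on \<open>k\<close> elements and \<open>1\<close> elsewhere, so \<open>c\<close> is the mean of
  \<open>e\<close> and \<open>1 - c\<^sup>2\<close> its variance, positive by the bounds on
  \<open>k\<close>. Pairing \<open>w\<close> with the signs \<open>e\<close> bounds the sum of
  absolute values from below.\<close>

lemma two_valued_weights:
  fixes V :: "'a set"
  assumes fin: "finite V" and k: "0 < k" "k < card V"
  defines "c \<equiv> 1 - 2 * real k / real (card V)"
  shows "\<exists>w::'a \<Rightarrow> real. sum w V = 1 \<and> (\<Sum>v\<in>V. (w v)\<^sup>2) = 1 \<and>
           sqrt ((real (card V) - 1) * (1 - c\<^sup>2)) + c \<le> (\<Sum>v\<in>V. \<bar>w v\<bar>)"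
proof -
  define N where "N = real (card V)"
  obtain K where K: "K \<subseteq> V" "card K = k" using k by (meson less_imp_le obtain_subset_with_card_n)
  define e where "e v = (if v \<in> K then -1 else 1 :: real)" for v
  have finK: "finite K" using K fin finite_subset by blast
  have N: "N > 0" using k by (simp add: N_def)
  have e2: "(e v)\<^sup>2 = 1" for v by (simp add: e_def)
  have c1: "1 - c\<^sup>2 > 0"
  proof -
    have "c < 1" "-1 < c" using k by (auto simp: c_def field_simps)
    then have "\<bar>c\<bar> < 1" by simp
    then show ?thesis by (simp add: abs_square_less_1)
  qed
  have sume: "sum e V = N * c"
  proof -
    have "sum e V = (\<Sum>v\<in>V. 1 - 2 * (if v \<in> K then 1 else 0))"
      by (intro sum.cong) (auto simp: e_def)
    also have "\<dots> = N - 2 * real (card (V \<inter> K))"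
      using fin by (simp add: sum_subtractf sum_distrib_left[symmetric] sum.If_cases N_def)
    also have "\<dots> = N * c" using K N by (simp add: c_def N_def[symmetric] Int_absorb1 field_simps)
    finally show ?thesis .
  qed
  define S where "S = sqrt ((N - 1) * (1 - c\<^sup>2))"
  \<comment> \<open>The condition on the sum of \<open>w\<close> fixes \<open>b\<close>. The one on
    the squares then reads \<open>a\<^sup>2 * (N\<^sup>2 * (1 - c\<^sup>2)) = N - 1\<close>, and
    \<open>a\<close> is its nonnegative root.\<close>
  define a where "a = S / (N * (1 - c\<^sup>2))"
  define b where "b = 1 / N - a * c"
  define w where "w v = a * e v + b" for v
  have N1: "N \<ge> 1" using k by (simp add: N_def)
  have S2: "S\<^sup>2 = (N - 1) * (1 - c\<^sup>2)" using N1 c1 by (simp add: S_def)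
  have aS: "a * (N * (1 - c\<^sup>2)) = S" using N c1 by (simp add: a_def)
  have a2: "a\<^sup>2 * (N\<^sup>2 * (1 - c\<^sup>2)) = N - 1"
  proof -
    have "(a\<^sup>2 * (N\<^sup>2 * (1 - c\<^sup>2))) * (1 - c\<^sup>2) = (N - 1) * (1 - c\<^sup>2)"
      using arg_cong[OF aS, of power2] S2 by (simp add: power2_eq_square algebra_simps)
    then show ?thesis using c1 by simp
  qed
  have bN: "N * b = 1 - N * a * c" using N by (simp add: b_def field_simps)
  have "sum w V = a * (N * c) + N * b"
    by (simp add: w_def sum.distrib sum_distrib_left[symmetric] sume N_def)
  then have 1: "sum w V = 1" using bN by simp
  have "(\<Sum>v\<in>V. (w v)\<^sup>2) = (\<Sum>v\<in>V. a\<^sup>2 + (2 * a * b) * e v + b\<^sup>2)"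
    by (intro sum.cong refl) (simp add: w_def power2_sum power_mult_distrib e2)
  also have "\<dots> = N * a\<^sup>2 + 2 * a * b * (N * c) + N * b\<^sup>2"
    by (simp add: sum.distrib sum_distrib_left[symmetric] sume N_def)
  finally have "N * (\<Sum>v\<in>V. (w v)\<^sup>2) = N\<^sup>2 * a\<^sup>2 + 2 * a * (N * b) * (N * c) + (N * b)\<^sup>2"
    by (simp add: power2_eq_square algebra_simps)
  also have "\<dots> = a\<^sup>2 * (N\<^sup>2 * (1 - c\<^sup>2)) + 1"
    unfolding bN by (simp add: power2_eq_square algebra_simps)
  finally have 2: "(\<Sum>v\<in>V. (w v)\<^sup>2) = 1" using a2 N by simp
  have "(\<Sum>v\<in>V. e v * w v) = (\<Sum>v\<in>V. a + b * e v)"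
    by (intro sum.cong refl) (simp add: w_def algebra_simps e2 power2_eq_square[symmetric])
  also have "\<dots> = N * a + (N * b) * c"
    by (simp add: sum.distrib sum_distrib_left[symmetric] sume N_def)
  also have "\<dots> = S + c" unfolding bN aS[symmetric] by (simp add: power2_eq_square algebra_simps)
  finally have "S + c = (\<Sum>v\<in>V. e v * w v)" by simp
  also have "\<dots> \<le> (\<Sum>v\<in>V. \<bar>w v\<bar>)" by (intro sum_mono) (auto simp: e_def)
  finally show ?thesis using 1 2 by (auto simp: S_def N_def)
qed

section \<open>Lower bounds for the norm of a projector\<close>

lemma affine_hull_simplex_vertices:
  fixes V :: "(real ^ 'n) set"
  assumes "simplex_vertices V"
  shows "affine hull V = UNIV"
  using assms aff_dim_affine_independent[of V] aff_dim_eq_full[of V]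
  by (simp add: simplex_vertices_def)

lemma poly_deg_le_1_affine_combination:
  assumes "p \<in> poly_deg_le_1" and "sum w V = 1"
  shows "p (\<Sum>v\<in>V. w v *\<^sub>R v) = (\<Sum>v\<in>V. w v * p v)"
proof -
  obtain c a where p: "\<And>x. p x = c + (\<Sum>i\<in>UNIV. a i * x $ i)"
    using assms(1) by (auto simp: poly_deg_le_1_def)
  have "(\<Sum>i\<in>UNIV. a i * (\<Sum>v\<in>V. w v * v $ i)) = (\<Sum>v\<in>V. w v * (\<Sum>i\<in>UNIV. a i * v $ i))"
    unfolding sum_distrib_left by (subst sum.swap) (simp add: mult.left_commute)
  moreover have "(\<Sum>v\<in>V. w v * c) = c" using assms(2) by (simp add: sum_distrib_right[symmetric])
  ultimately show ?thesis by (simp add: p distrib_left sum.distrib)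
qed

lemma continuous_on_poly_deg_le_1: "p \<in> poly_deg_le_1 \<Longrightarrow> continuous_on S p"
proof -
  assume "p \<in> poly_deg_le_1"
  then obtain c a where "p = (\<lambda>x. c + (\<Sum>i\<in>UNIV. a i * x $ i))"
    by (auto simp: poly_deg_le_1_def)
  then show ?thesis by (auto intro!: continuous_intros)
qed

lemma abs_le_unif_norm:
  assumes "compact K" "f \<in> cont_fun K" "x \<in> K"
  shows "\<bar>f x\<bar> \<le> unif_norm K f"
proof -
  have "compact ((\<lambda>x. \<bar>f x\<bar>) ` K)"
    using assms by (intro compact_continuous_image continuous_intros) (auto simp: cont_fun_def)
  then show ?thesis unfolding unif_norm_def
    using assms by (intro cSUP_upper bounded_imp_bdd_above compact_imp_bounded)
qed

text \<open>Needed because the supremum in \<open>projector_norm\<close> dominates its members only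
  if it is over a bounded set. Affine coordinates over \<open>V\<close> bound \<open>P f z\<close>
  at each single point \<open>z\<close> uniformly in \<open>f\<close>; the values at
  \<open>0\<close> and at the unit vectors then control the affine function \<open>P f\<close> on
  the whole ball.\<close>

lemma projector_unif_norm_bdd_above:
  fixes V :: "(real ^ 'n) set"
  assumes P: "interpolation_projector (cball 0 1) V P"
  shows "\<exists>C. \<forall>f\<in>cont_fun (cball 0 1). unif_norm (cball 0 1) f \<le> 1 \<longrightarrow> unif_norm (cball 0 1) (P f) \<le> C"
proof -
  let ?B = "cball 0 1 :: (real ^ 'n) set"
  have V: "V \<subseteq> ?B" "simplex_vertices V" "finite V"
    using P by (auto simp: interpolation_projector_def simplex_vertices_def)
  have "\<exists>C. \<forall>f\<in>cont_fun ?B. unif_norm ?B f \<le> 1 \<longrightarrow> \<bar>P f z\<bar> \<le> C" for z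
  proof -
    have "z \<in> affine hull V" using affine_hull_simplex_vertices[OF V(2)] by simp
    then obtain w where w: "sum w V = 1" "(\<Sum>v\<in>V. w v *\<^sub>R v) = z"
      using affine_hull_finite[OF V(3)] by auto
    have "\<bar>P f z\<bar> \<le> (\<Sum>v\<in>V. \<bar>w v\<bar>)" if f: "f \<in> cont_fun ?B" "unif_norm ?B f \<le> 1" for f
    proof -
      have "P f z = (\<Sum>v\<in>V. w v * P f v)"
        using poly_deg_le_1_affine_combination[of "P f" w V] P f w
        by (auto simp: interpolation_projector_def)
      also have "\<dots> = (\<Sum>v\<in>V. w v * f v)"
        using P f by (auto simp: interpolation_projector_def)
      also have "\<bar>\<dots>\<bar> \<le> (\<Sum>v\<in>V. \<bar>w v\<bar> * \<bar>f v\<bar>)"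
        using sum_abs[of "\<lambda>v. w v * f v" V] by (simp add: abs_mult)
      also have "\<dots> \<le> (\<Sum>v\<in>V. \<bar>w v\<bar> * 1)"
        using f V abs_le_unif_norm[OF compact_cball f(1)]
        by (intro sum_mono mult_left_mono) (fastforce simp: subset_iff)+
      finally show ?thesis by simp
    qed
    then show ?thesis by blast
  qed
  then obtain C where C: "\<And>z f. f \<in> cont_fun ?B \<Longrightarrow> unif_norm ?B f \<le> 1 \<Longrightarrow> \<bar>P f z\<bar> \<le> C z" by metis
  have "unif_norm ?B (P f) \<le> C 0 + (\<Sum>i\<in>UNIV. C (axis i 1) + C 0)"
    if f: "f \<in> cont_fun ?B" "unif_norm ?B f \<le> 1" for f
    unfolding unif_norm_def
  proof (rule cSUP_least)
    fix x :: "real ^ 'n" assume x: "x \<in> ?B"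
    have "P f \<in> poly_deg_le_1" using P f by (auto simp: interpolation_projector_def)
    then obtain c a where p: "\<And>x. P f x = c + (\<Sum>i\<in>UNIV. a i * x $ i)"
      by (auto simp: poly_deg_le_1_def)
    have c: "c = P f 0" by (simp add: p)
    have a: "a i = P f (axis i 1) - P f 0" for i
      by (simp add: p axis_def if_distrib cong: if_cong)
    have "\<bar>P f x\<bar> \<le> \<bar>c\<bar> + (\<Sum>i\<in>UNIV. \<bar>a i * x $ i\<bar>)"
      unfolding p by (intro order_trans[OF abs_triangle_ineq] add_left_mono sum_abs)
    also have "\<dots> \<le> C 0 + (\<Sum>i\<in>UNIV. C (axis i 1) + C 0)"
    proof (intro add_mono sum_mono)
      show "\<bar>c\<bar> \<le> C 0" using C[OF f] by (simp add: c)
      fix i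
      have "\<bar>x $ i\<bar> \<le> 1" using component_le_norm_cart[of x i] x by simp
      then have "\<bar>a i * x $ i\<bar> \<le> \<bar>a i\<bar>" by (simp add: abs_mult mult_left_le)
      also have "\<dots> \<le> C (axis i 1) + C 0"
        using C[OF f, of "axis i 1"] C[OF f, of 0] by (simp add: a)
      finally show "\<bar>a i * x $ i\<bar> \<le> C (axis i 1) + C 0" .
    qed
    finally show "\<bar>P f x\<bar> \<le> C 0 + (\<Sum>i\<in>UNIV. C (axis i 1) + C 0)" .
  qed simp
  then show ?thesis by blast
qed

text \<open>The test function is a Tietze extension of the signs of \<open>w\<close> from the finite
  set \<open>V\<close> to the ball; its interpolant takes the value
  \<open>\<Sum>v\<in>V. \<bar>w v\<bar>\<close> at the point with barycentric coordinates
  \<open>w\<close>.\<close>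

lemma projector_norm_ge_sum_abs:
  fixes V :: "(real ^ 'n) set"
  assumes P: "interpolation_projector (cball 0 1) V P"
    and w: "sum w V = 1" and y: "norm (\<Sum>v\<in>V. w v *\<^sub>R v) \<le> 1"
  shows "(\<Sum>v\<in>V. \<bar>w v\<bar>) \<le> projector_norm (cball 0 1) P"
proof -
  let ?B = "cball 0 1 :: (real ^ 'n) set"
  have V: "V \<subseteq> ?B" "finite V"
    using P by (auto simp: interpolation_projector_def simplex_vertices_def)
  obtain f where fc: "continuous_on ?B f" and fV: "\<And>v. v \<in> V \<Longrightarrow> f v = sgn (w v)"
    and f1: "\<And>x. x \<in> ?B \<Longrightarrow> f x \<in> cbox (-1) (1::real)"
  proof (rule Tietze_closed_interval_1[of V "\<lambda>v. sgn (w v)" ?B "-1" 1])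
    show "continuous_on V (\<lambda>v. sgn (w v))" using V by (simp add: continuous_on_finite)
    show "closedin (top_of_set ?B) V" using V by (simp add: finite_imp_closed closed_subset)
    fix g assume "continuous_on ?B g" "\<And>v. v \<in> V \<Longrightarrow> g v = sgn (w v)"
      "\<And>x. x \<in> ?B \<Longrightarrow> g x \<in> cbox (-1) (1::real)"
    then show thesis by (rule that)
  qed (simp_all add: sgn_if)
  have f: "f \<in> cont_fun ?B" using fc by (simp add: cont_fun_def)
  have fn: "unif_norm ?B f \<le> 1" unfolding unif_norm_def
    using f1 by (intro cSUP_least) (auto simp: abs_le_iff)
  have Pf: "P f \<in> poly_deg_le_1" "\<And>v. v \<in> V \<Longrightarrow> P f v = f v"
    using P f by (auto simp: interpolation_projector_def)
  let ?y = "\<Sum>v\<in>V. w v *\<^sub>R v"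
  have "(\<Sum>v\<in>V. \<bar>w v\<bar>) = (\<Sum>v\<in>V. w v * P f v)"
    by (intro sum.cong) (auto simp: Pf fV abs_sgn)
  also have "\<dots> = P f ?y" using poly_deg_le_1_affine_combination[OF Pf(1) w] by simp
  also have "\<dots> \<le> \<bar>P f ?y\<bar>" by simp
  also have "\<dots> \<le> unif_norm ?B (P f)"
    using y continuous_on_poly_deg_le_1[OF Pf(1)]
    by (intro abs_le_unif_norm) (auto simp: cont_fun_def)
  also have "\<dots> \<le> projector_norm ?B P"
    unfolding projector_norm_def using f fn projector_unif_norm_bdd_above[OF P]
    by (intro cSUP_upper) (auto simp: bdd_above_def)
  finally show ?thesis .
qed

text \<open>Permuting \<open>w\<close> brings the point into the ball and leaves the sum of absolute
  values unchanged.\<close>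

lemma projector_norm_ge_weights:
  fixes V :: "(real ^ 'n) set"
  assumes P: "interpolation_projector (cball 0 1) V P"
    and w: "sum w V = 1" "(\<Sum>v\<in>V. (w v)\<^sup>2) = 1"
  shows "(\<Sum>v\<in>V. \<bar>w v\<bar>) \<le> projector_norm (cball 0 1) P"
proof -
  have V: "V \<subseteq> cball 0 1" "finite V"
    using P by (auto simp: interpolation_projector_def simplex_vertices_def)
  obtain p where p: "p permutes V" "norm (\<Sum>v\<in>V. w (p v) *\<^sub>R v) \<le> 1"
    using exists_permutation_norm_le_1[OF V(2) w] V(1) by (auto simp: subset_iff)
  have "(\<Sum>v\<in>V. \<bar>w (p v)\<bar>) \<le> projector_norm (cball 0 1) P"
    using w p sum.permute[OF p(1), of w] by (intro projector_norm_ge_sum_abs[OF P]) (auto simp: comp_def)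
  then show ?thesis using sum.permute[OF p(1), of "\<lambda>v. \<bar>w v\<bar>"] by (simp add: comp_def)
qed

text \<open>All weight is placed on one vertex. This bounds the set under the infimum in
  \<open>theta\<close> from below and settles the lower bound in dimension 1.\<close>

lemma projector_norm_ge_1:
  assumes P: "interpolation_projector (cball 0 1) V P"
  shows "1 \<le> projector_norm (cball 0 1) P"
proof -
  have "finite V" "V \<noteq> {}"
    using P by (auto simp: interpolation_projector_def simplex_vertices_def)
  then obtain z where z: "z \<in> V" "finite V" by blast
  then show ?thesis
    using projector_norm_ge_weights[OF P, of "\<lambda>v. if v = z then 1 else 0"]
    by (simp add: if_distrib[of "\<lambda>r. r\<^sup>2"] if_distrib[of abs] cong: if_cong)
qed

text \<open>\<open>c\<close> is the mean of a sign vector with \<open>k\<close> negative entries.\<close>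

definition ball_bound :: "nat \<Rightarrow> nat \<Rightarrow> real" where
  "ball_bound n k = (let c = 1 - 2 * real k / (real n + 1) in sqrt (real n * (1 - c\<^sup>2)) + c)"

lemma projector_norm_ge_ball_bound:
  fixes V :: "(real ^ 'n) set"
  assumes P: "interpolation_projector (cball 0 1) V P" and k: "0 < k" "k \<le> CARD('n)"
  shows "ball_bound CARD('n) k \<le> projector_norm (cball 0 1) P"
proof -
  have V: "card V = CARD('n) + 1" "finite V"
    using P by (auto simp: interpolation_projector_def simplex_vertices_def)
  show ?thesis
    using two_valued_weights[OF V(2) k(1)] k V(1) projector_norm_ge_weights[OF P]
    by (force simp: ball_bound_def Let_def add.commute)
qed

section \<open>Comparison of \<open>ball_bound\<close> with the square roots\<close>

text \<open>At \<open>c = 0\<close> the expression equals \<open>sqrt n\<close>, and it is larger as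
  soon as \<open>0 < c\<close> and \<open>c * (n + 1) < 2 * sqrt n\<close>. The choice
  \<open>k = n div 2\<close> gives the least positive mean of \<open>n + 1\<close> signs, namely
  \<open>1 / (n + 1)\<close> or \<open>2 / (n + 1)\<close> according to parity.\<close>

lemma ball_bound_gt_sqrt:
  assumes "n \<ge> 2"
  obtains k where "0 < k" "k \<le> n" "sqrt (real n) < ball_bound n k"
proof -
  define k where "k = n div 2"
  define c where "c = 1 - 2 * real k / (real n + 1)"
  have c: "c = (if even n then 1 else 2) / (real n + 1)"
    unfolding c_def k_def by (auto elim!: evenE oddE simp: field_simps)
  have c0: "c > 0" by (simp add: c)
  have "sqrt (real n) > 1" using assms by simp
  moreover have "c * (real n + 1) \<le> 2" by (simp add: c)
  ultimately have small: "c * (real n + 1) < 2 * sqrt (real n)" by linarith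
  have sq: "(sqrt (real n))\<^sup>2 = real n" by simp
  have "(sqrt (real n) - c)\<^sup>2 = real n * (1 - c\<^sup>2) - c * (2 * sqrt (real n) - c * (real n + 1))"
    unfolding power2_diff sq by (simp add: power2_eq_square algebra_simps)
  also have "\<dots> < real n * (1 - c\<^sup>2)" using c0 small by simp
  finally have "sqrt (real n) - c < sqrt (real n * (1 - c\<^sup>2))" by (rule real_less_rsqrt)
  then have "sqrt (real n) < ball_bound n k" by (simp add: ball_bound_def Let_def c_def)
  moreover have "0 < k" "k \<le> n" using assms by (auto simp: k_def)
  ultimately show ?thesis using that by blast
qed

text \<open>With \<open>m = sqrt (n + 1)\<close> and \<open>c = 1 / m\<close> the radicand is the
  square of \<open>m - 1 / m\<close>, so the bound is \<open>m\<close>. The required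
  \<open>k = m * (m - 1) / 2\<close> is an integer, since one of two consecutive numbers is
  even.\<close>

lemma ball_bound_eq_sqrt:
  assumes n: "n > 0" and m: "sqrt (real n + 1) \<in> \<int>"
  obtains k where "0 < k" "k \<le> n" "ball_bound n k = sqrt (real n + 1)"
proof -
  obtain j :: int where j: "sqrt (real n + 1) = of_int j" using m by (auto elim: Ints_cases)
  then have "real_of_int j > 0" using n by (metis add_nonneg_pos of_nat_0_le_iff real_sqrt_gt_zero zero_less_one)
  then obtain m where m: "sqrt (real n + 1) = real m" using j by (metis of_int_0_less_iff of_int_of_nat_eq zero_less_imp_eq_int)
  have "real (m * m) = real (n + 1)" using m by (metis of_nat_0_le_iff of_nat_1 of_nat_add of_nat_mult real_sqrt_ge_0_iff real_sqrt_mult_self abs_of_nonneg add_nonneg_nonneg zero_le_one)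
  then have mm: "m * m = n + 1" by (simp only: of_nat_eq_iff)
  have m2: "m \<ge> 2" using mm n by (cases m; cases "m - 1") auto
  \<comment> \<open>chosen so that \<open>1 - 2 k / (n + 1) = 1 / m\<close>\<close>
  define k where "k = m * (m - 1) div 2"
  have "even (m * (m - 1))" using m2 by auto
  then have k2: "2 * k = m * (m - 1)" by (simp add: k_def)
  have "2 * k + m = n + 1" using k2 m2 mm by (cases m) auto
  then have rk: "2 * real k = real n + 1 - real m" by linarith
  have rmm: "real n + 1 = real m * real m" using mm by (metis of_nat_1 of_nat_add of_nat_mult)
  have c: "1 - 2 * real k / (real n + 1) = 1 / real m"
    unfolding rk rmm using m2 by (simp add: field_simps)
  have rn: "real n = real m * real m - 1" using rmm by simp
  have "real n * (1 - (1 / real m)\<^sup>2) = (real m - 1 / real m)\<^sup>2"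
    unfolding rn using m2 by (simp add: power2_eq_square field_simps)
  moreover have "real m - 1 / real m \<ge> 0"
    using m2 mult_mono[of 1 "real m" 1 "real m"] by (simp add: field_simps)
  ultimately have "ball_bound n k = real m" by (simp add: ball_bound_def Let_def c)
  moreover have "0 < k" "k \<le> n" using m2 k2 \<open>2 * k + m = n + 1\<close> by (auto intro: Nat.gr0I)
  ultimately show ?thesis using that m by metis
qed

text \<open>Cauchy-Schwarz for \<open>(r, 1)\<close> and the unit vector \<open>(s, c)\<close>,
  written as Lagrange's identity. In case of equality the remainder vanishes, so
  \<open>s = r * c\<close>, and the bound becomes \<open>(n + 1) * c = n + 1 - 2 * k\<close>, an
  integer.\<close>

lemma ball_bound_le_sqrt:
  assumes k: "k \<le> n + 1"
  shows "ball_bound n k \<le> sqrt (real n + 1)"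
    and "ball_bound n k = sqrt (real n + 1) \<Longrightarrow> sqrt (real n + 1) \<in> \<int>"
proof -
  define c where "c = 1 - 2 * real k / (real n + 1)"
  have "\<bar>c\<bar> \<le> 1" using k by (auto simp: c_def abs_le_iff field_simps)
  then have c1: "1 - c\<^sup>2 \<ge> 0" by (simp add: abs_square_le_1)
  define s where "s = sqrt (1 - c\<^sup>2)"
  define r where "r = sqrt (real n)"
  have s2: "s\<^sup>2 = 1 - c\<^sup>2" and r2: "r\<^sup>2 = real n" and s0: "s \<ge> 0" and r0: "r \<ge> 0"
    using c1 by (auto simp: s_def r_def)
  have b: "ball_bound n k = r * s + c"
    by (simp add: ball_bound_def Let_def c_def r_def s_def real_sqrt_mult)
  have id: "(r * s + c)\<^sup>2 + (r * c - s)\<^sup>2 = real n + 1"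
  proof -
    have "(r * s + c)\<^sup>2 + (r * c - s)\<^sup>2 = (r\<^sup>2 + 1) * (s\<^sup>2 + c\<^sup>2)"
      by (simp add: power2_eq_square algebra_simps)
    then show ?thesis by (simp add: s2 r2)
  qed
  then have "(r * s + c)\<^sup>2 \<le> real n + 1" using zero_le_power2[of "r * c - s"] by linarith
  then show "ball_bound n k \<le> sqrt (real n + 1)" unfolding b by (rule real_le_rsqrt)
  assume e: "ball_bound n k = sqrt (real n + 1)"
  then have "r * c = s" using id by (simp add: b)
  then have "ball_bound n k = (r\<^sup>2 + 1) * c" unfolding b by (simp add: power2_eq_square algebra_simps)
  also have "\<dots> = of_int (int (n + 1) - 2 * int k)" by (simp add: r2 c_def field_simps)
  finally show "sqrt (real n + 1) \<in> \<int>" unfolding e by (metis Ints_of_int)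
qed

section \<open>The inscribed regular simplex\<close>

text \<open>The Gram matrix describes the regular simplex inscribed in the unit sphere and centred
  at the origin; all later computations use inner products only.\<close>

definition regular_simplex :: "(real ^ 'n) set \<Rightarrow> bool" where
  "regular_simplex V \<longleftrightarrow> finite V \<and> card V = CARD('n) + 1 \<and>
     (\<forall>u\<in>V. \<forall>v\<in>V. u \<bullet> v = (if u = v then 1 else - 1 / real CARD('n)))"

text \<open>The option type supplies \<open>n + 1\<close> indices: \<open>None\<close> gives the
  unit vector opposite to the all-ones vector \<open>s\<close>, and \<open>Some i\<close> a scaled
  unit vector shifted along \<open>s\<close>.\<close>

lemma regular_simplex_exists: "\<exists>V :: (real ^ 'n) set. regular_simplex V"
proof -
  define n where "n = real CARD('n)"
  define r where "r = sqrt n"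
  define a where "a = sqrt (1 + 1 / n)"
  define b where "b = (1 / r - a) / n"
  define s :: "real ^ 'n" where "s = (\<chi> i. 1)"
  \<comment> \<open>\<open>a\<close> and \<open>b\<close> solve \<open>a\<^sup>2 = 1 + 1 / n\<close> and \<open>a + n b = 1 / sqrt n\<close>, which give the inner products \<open>- 1 / n\<close>.\<close>
  define f where "f t = (case t of None \<Rightarrow> (- 1 / r) *\<^sub>R s | Some i \<Rightarrow> a *\<^sub>R axis i 1 + b *\<^sub>R s)" for t
  have n: "n > 0" by (simp add: n_def)
  have r: "r > 0" "r * r = n" and a: "a * a = 1 + 1 / n" using n by (auto simp: r_def a_def)
  have rr: "1 / r * (1 / r) = 1 / n" using r by simp
  have ss: "s \<bullet> s = n" by (simp add: s_def inner_vec_def n_def)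
  have as: "axis i 1 \<bullet> s = 1" "s \<bullet> axis i 1 = 1" for i
    by (simp_all add: s_def inner_axis inner_axis')
  have aa: "axis i 1 \<bullet> (axis j 1 :: real ^ 'n) = (if i = j then 1 else 0)" for i j
    by (simp add: inner_axis_axis)
  have nb: "n * b = 1 / r - a" using n by (simp add: b_def)
  have off: "2 * a * b + b * b * n = - 1 / n"
  proof -
    have "n * (2 * a * b + b * b * n) = (n * b) * (2 * a + n * b)" by (simp add: algebra_simps)
    also have "\<dots> = 1 / r * (1 / r) - a * a" unfolding nb by (simp add: algebra_simps)
    also have "\<dots> = - 1" unfolding rr a by simp
    finally show ?thesis using n by (simp add: field_simps)
  qed
  have "a + b * n = 1 / r" using nb by (simp add: mult.commute)
  then have mixed: "1 / r * (a + b * n) = 1 / n" using rr by simp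
  have f: "f t \<bullet> f u = (if t = u then 1 else - 1 / n)" for t u
  proof (cases t; cases u)
    fix i j assume "t = Some i" "u = Some j"
    moreover have "(a *\<^sub>R axis i 1 + b *\<^sub>R s) \<bullet> (a *\<^sub>R axis j 1 + b *\<^sub>R s)
        = a * a * (if i = j then 1 else 0) + (2 * a * b + b * b * n)"
      by (simp add: inner_add_left inner_add_right ss as aa algebra_simps)
    ultimately show ?thesis unfolding off by (simp add: f_def a)
  next
    fix i assume "t = None" "u = Some i"
    then show ?thesis using mixed
      by (simp add: f_def inner_add_left inner_add_right ss as algebra_simps add_divide_distrib)
  next
    fix i assume "t = Some i" "u = None"
    then show ?thesis using mixed
      by (simp add: f_def inner_add_left inner_add_right ss as algebra_simps add_divide_distrib)
  next
    assume "t = None" "u = None"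
    then show ?thesis using rr r n by (simp add: f_def ss)
  qed
  have inj: "inj f"
  proof (rule injI, rule ccontr)
    fix t u assume "f t = f u" "t \<noteq> u"
    then show False using f[of t u] f[of t t] n by (simp add: field_simps)
  qed
  have "regular_simplex (range f)"
    unfolding regular_simplex_def n_def[symmetric]
    using inj f by (auto simp: card_image card_UNIV_option inj_eq n_def)
  then show ?thesis by blast
qed

text \<open>In the inner product of an affine dependence \<open>U\<close> with a vertex
  \<open>v\<close>, the constant part of the Gram matrix cancels because \<open>U\<close> sums to
  \<open>0\<close>; what remains is a positive multiple of \<open>U v\<close>.\<close>

lemma regular_simplex_simplex_vertices:
  fixes V :: "(real ^ 'n) set"
  assumes "regular_simplex V"
  shows "simplex_vertices V"
proof -
  have V: "finite V" "card V = CARD('n) + 1"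
    "\<And>u v. u \<in> V \<Longrightarrow> v \<in> V \<Longrightarrow> u \<bullet> v = (if u = v then 1 else - 1 / real CARD('n))"
    using assms by (auto simp: regular_simplex_def)
  have "U v = 0" if U: "sum U V = 0" "(\<Sum>v\<in>V. U v *\<^sub>R v) = 0" and v: "v \<in> V" for U v
  proof -
    have "0 = (\<Sum>u\<in>V. U u *\<^sub>R u) \<bullet> v" by (simp add: U)
    also have "\<dots> = (\<Sum>u\<in>V. U u * (u \<bullet> v))" by (simp add: inner_sum_left)
    also have "\<dots> = (\<Sum>u\<in>V. (if u = v then U u * (1 + 1 / real CARD('n)) else 0) - U u / real CARD('n))"
      using v by (intro sum.cong) (auto simp: V(3) algebra_simps)
    also have "\<dots> = U v * (1 + 1 / real CARD('n))"
      using V(1) v U by (simp add: sum_subtractf sum_divide_distrib[symmetric])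
    finally have "U v * (1 + 1 / real CARD('n)) = 0" by simp
    moreover have "1 + 1 / real CARD('n) > 0" by (simp add: add_pos_nonneg)
    ultimately show ?thesis by (metis less_irrefl mult_eq_0_iff)
  qed
  then show ?thesis
    using V by (auto simp: simplex_vertices_def affine_dependent_explicit_finite)
qed

text \<open>The summands are the absolute barycentric coordinates of \<open>x\<close>. With
  \<open>e\<close> as their signs, the sum is \<open>c + n * (z \<bullet> x) / N\<close> for the
  signed vertex sum \<open>z\<close>; Cauchy-Schwarz and the exact norm of \<open>z\<close> give the
  bound, with \<open>k\<close> the number of negative coordinates.\<close>

lemma regular_simplex_barycentric_sum_le:
  fixes V :: "(real ^ 'n) set"
  assumes "regular_simplex V" and x: "norm x \<le> 1"
  obtains k where "k \<le> CARD('n) + 1"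
    "(\<Sum>v\<in>V. \<bar>(1 + real CARD('n) * (v \<bullet> x)) / (real CARD('n) + 1)\<bar>) \<le> ball_bound CARD('n) k"
proof -
  define n where "n = real CARD('n)"
  define N where "N = n + 1"
  have V: "finite V" "real (card V) = N"
    "\<And>u v. u \<in> V \<Longrightarrow> v \<in> V \<Longrightarrow> u \<bullet> v = (if u = v then 1 else - 1 / n)"
    using assms(1) by (auto simp: regular_simplex_def N_def n_def)
  have n: "n > 0" "N > 0" by (auto simp: n_def N_def)
  define K where "K = {v \<in> V. 1 + n * (v \<bullet> x) < 0}"
  define c where "c = 1 - 2 * real (card K) / N"
  define e where "e v = (if v \<in> K then -1 else 1 :: real)" for v
  have K: "K \<subseteq> V" by (auto simp: K_def)
  have "sum e V = (\<Sum>v\<in>V. 1 - 2 * (if v \<in> K then 1 else 0))"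
    by (intro sum.cong) (auto simp: e_def)
  also have "\<dots> = N - 2 * real (card (V \<inter> K))"
    using V by (simp add: sum_subtractf sum_distrib_left[symmetric] sum.If_cases)
  finally have sume: "sum e V = N * c" using K n by (simp add: c_def Int_absorb1 right_diff_distrib)
  let ?z = "\<Sum>v\<in>V. e v *\<^sub>R v"
  have "(norm ?z)\<^sup>2 = (\<Sum>u\<in>V. \<Sum>v\<in>V. e u * e v * (u \<bullet> v))"
    by (simp add: power2_norm_eq_inner inner_sum_left inner_sum_right mult.assoc sum_distrib_left
        inner_commute mult.left_commute)
  \<comment> \<open>The Gram matrix is \<open>1 + 1 / n\<close> times the identity minus
    \<open>1 / n\<close> times the all-ones matrix, so only the number of signs and their sum
    enter.\<close>
  also have "\<dots> = (\<Sum>u\<in>V. \<Sum>v\<in>V. (if u = v then 1 + 1 / n else 0) - e u * (e v / n))"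
    by (intro sum.cong refl) (auto simp: V(3) e_def)
  also have "\<dots> = N * (1 + 1 / n) - (N * c) * (N * c / n)"
    using V by (simp add: sum_subtractf sum_distrib_left[symmetric] sum_distrib_right[symmetric]
        sum_divide_distrib[symmetric] sume)
  finally have "n * (norm ?z)\<^sup>2 = n * (N * (1 + 1 / n) - (N * c) * (N * c / n))" by simp
  also have "\<dots> = N * (n + 1) - (N * c) * (N * c)" using n(1) by (simp add: field_simps)
  finally have z: "n * (norm ?z)\<^sup>2 = N\<^sup>2 * (1 - c\<^sup>2)"
    unfolding N_def[symmetric] by (simp add: power2_eq_square algebra_simps)
  have "(n * norm ?z / N)\<^sup>2 = n * (n * (norm ?z)\<^sup>2) / N\<^sup>2" by (simp add: power2_eq_square)
  also have "\<dots> = n * (1 - c\<^sup>2)" unfolding z using n by simp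
  finally have nz: "n * norm ?z / N \<le> sqrt (n * (1 - c\<^sup>2))" by (intro real_le_rsqrt) simp
  have "(\<Sum>v\<in>V. \<bar>(1 + n * (v \<bullet> x)) / N\<bar>) = (\<Sum>v\<in>V. (e v + n * ((e v *\<^sub>R v) \<bullet> x)) / N)"
    using n by (intro sum.cong refl) (auto simp: e_def K_def abs_if field_simps)
  also have "\<dots> = c + n * (?z \<bullet> x) / N"
    using n by (simp add: sum_divide_distrib[symmetric] sum.distrib sum_distrib_left[symmetric]
        inner_sum_left[symmetric] sume add_divide_distrib del: inner_scaleR_left)
  also have "\<dots> \<le> c + n * norm ?z / N"
  proof -
    have "?z \<bullet> x \<le> norm ?z * norm x" by (rule norm_cauchy_schwarz)
    also have "\<dots> \<le> norm ?z" using x by (simp add: mult_left_le)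
    finally show ?thesis using n by (intro add_left_mono divide_right_mono mult_left_mono) auto
  qed
  also have "\<dots> \<le> ball_bound CARD('n) (card K)"
    using nz by (simp add: ball_bound_def Let_def c_def n_def N_def)
  finally show ?thesis
  proof (intro that)
    show "card K \<le> CARD('n) + 1"
      using card_mono[OF V(1) K] assms(1) by (simp add: regular_simplex_def)
  qed (simp add: n_def N_def)
qed

text \<open>Interpolation at the regular simplex. \<open>M\<close> stays arbitrary because it is
  later taken to be \<open>sqrt (n + 1)\<close>, \<open>1\<close> in dimension 1, and the largest
  \<open>ball_bound\<close>.\<close>

lemma exists_projector_norm_le:
  assumes M: "\<And>k. k \<le> CARD('n) + 1 \<Longrightarrow> ball_bound CARD('n) k \<le> M"
  shows "\<exists>V P. interpolation_projector (cball 0 1 :: (real ^ 'n) set) V P \<and>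
           projector_norm (cball 0 1) P \<le> M"
proof -
  let ?B = "cball 0 1 :: (real ^ 'n) set"
  obtain V :: "(real ^ 'n) set" where reg: "regular_simplex V" using regular_simplex_exists by blast
  define n where "n = real CARD('n)"
  have n: "n > 0" by (simp add: n_def)
  have V: "finite V" "\<And>u v. u \<in> V \<Longrightarrow> v \<in> V \<Longrightarrow> u \<bullet> v = (if u = v then 1 else - 1 / n)"
    using reg by (auto simp: regular_simplex_def n_def)
  have VB: "V \<subseteq> ?B" using V(2) by (auto simp: norm_eq_sqrt_inner)
  \<comment> \<open>The barycentric coordinates: on vertices the numerator is \<open>1 + n\<close>
    or \<open>1 - 1\<close>.\<close>
  define l where "l v x = (1 + n * (v \<bullet> x)) / (n + 1)" for v x :: "real ^ 'n"
  define P where "P f x = (\<Sum>v\<in>V. f v * l v x)" for f x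
  have l: "l v u = (if v = u then 1 else 0)" if "v \<in> V" "u \<in> V" for u v
    using n that by (simp add: l_def V(2))
  have "P f \<in> poly_deg_le_1" for f
  proof -
    have Pf: "P f x = (\<Sum>v\<in>V. f v / (n + 1)) + (\<Sum>i\<in>UNIV. (\<Sum>v\<in>V. f v * n / (n + 1) * v $ i) * x $ i)" for x
    proof -
      have "P f x = (\<Sum>v\<in>V. f v / (n + 1) + f v * n / (n + 1) * (\<Sum>i\<in>UNIV. v $ i * x $ i))"
        using n by (intro sum.cong refl[of V] trans[OF P_def])
          (simp add: l_def inner_vec_def add_divide_distrib algebra_simps)
      also have "\<dots> = (\<Sum>v\<in>V. f v / (n + 1)) + (\<Sum>v\<in>V. \<Sum>i\<in>UNIV. f v * n / (n + 1) * v $ i * x $ i)"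
        by (simp add: sum.distrib sum_distrib_left mult.assoc)
      also have "(\<Sum>v\<in>V. \<Sum>i\<in>UNIV. f v * n / (n + 1) * v $ i * x $ i)
          = (\<Sum>i\<in>UNIV. (\<Sum>v\<in>V. f v * n / (n + 1) * v $ i) * x $ i)"
        unfolding sum_distrib_right by (rule sum.swap)
      finally show ?thesis .
    qed
    show ?thesis unfolding poly_deg_le_1_def mem_Collect_eq by (intro exI allI) (rule Pf)
  qed
  moreover have "P f v = f v" if "v \<in> V" for f v
    using that V(1) by (simp add: P_def l if_distrib cong: if_cong)
  ultimately have IP: "interpolation_projector ?B V P"
    using VB regular_simplex_simplex_vertices[OF reg] by (simp add: interpolation_projector_def)
  have "unif_norm ?B (P f) \<le> M" if f: "f \<in> cont_fun ?B" "unif_norm ?B f \<le> 1" for f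
    unfolding unif_norm_def
  proof (rule cSUP_least)
    fix x :: "real ^ 'n" assume x: "x \<in> ?B"
    have f1: "\<bar>f v\<bar> \<le> 1" if "v \<in> V" for v
      using abs_le_unif_norm[OF compact_cball f(1), of v] f(2) that VB by fastforce
    have "\<bar>P f x\<bar> \<le> (\<Sum>v\<in>V. \<bar>f v\<bar> * \<bar>l v x\<bar>)"
      unfolding P_def using sum_abs[of "\<lambda>v. f v * l v x" V] by (simp add: abs_mult)
    also have "\<dots> \<le> (\<Sum>v\<in>V. 1 * \<bar>l v x\<bar>)" using f1 by (intro sum_mono mult_right_mono) auto
    also have "\<dots> \<le> M"
      using regular_simplex_barycentric_sum_le[OF reg, of x] x M
      by (simp add: l_def n_def) (metis order_trans)
    finally show "\<bar>P f x\<bar> \<le> M" .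
  qed simp
  \<comment> \<open>The supremum in \<open>projector_norm\<close> has to range over a nonempty
    set.\<close>
  moreover have "(\<lambda>x. 0) \<in> {f \<in> cont_fun ?B. unif_norm ?B f \<le> 1}"
    by (simp add: cont_fun_def unif_norm_def)
  ultimately have "projector_norm ?B P \<le> M"
    unfolding projector_norm_def by (intro cSUP_least) blast+
  then show ?thesis using IP by blast
qed

section \<open>Bounds for \<open>theta\<close> and the equality cases\<close>

lemma theta_cball_le:
  assumes "\<And>k. k \<le> CARD('n) + 1 \<Longrightarrow> ball_bound CARD('n) k \<le> M"
  shows "theta (cball 0 1 :: (real ^ 'n) set) \<le> M"
proof -
  obtain V P where P: "interpolation_projector (cball 0 1 :: (real ^ 'n) set) V P"
    "projector_norm (cball 0 1) P \<le> M"
    using exists_projector_norm_le[OF assms] by blast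
  have "theta (cball 0 1 :: (real ^ 'n) set) \<le> projector_norm (cball 0 1) P"
    unfolding theta_def using P projector_norm_ge_1
    by (intro cInf_lower) (auto simp: bdd_below_def)
  then show ?thesis using P by linarith
qed

lemma theta_cball_ge:
  assumes "\<And>V P. interpolation_projector (cball 0 1 :: (real ^ 'n) set) V P
    \<Longrightarrow> L \<le> projector_norm (cball 0 1) P"
  shows "L \<le> theta (cball 0 1 :: (real ^ 'n) set)"
proof -
  \<comment> \<open>The infimum is at least \<open>L\<close> only because some projector
    exists.\<close>
  have "\<exists>V P. interpolation_projector (cball 0 1 :: (real ^ 'n) set) V P"
    using exists_projector_norm_le[of "sqrt (real CARD('n) + 1)", OF ball_bound_le_sqrt(1)] by blast
  then show ?thesis unfolding theta_def using assms by (intro cInf_greatest) auto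
qed

theorem mainTheorem2:
  fixes B :: "(real ^ 'n) set"
  defines "B \<equiv> cball 0 1"
  shows "sqrt (real CARD('n)) \<le> theta B \<and> theta B \<le> sqrt (real CARD('n) + 1)
    \<and> (theta B = sqrt (real CARD('n)) \<longleftrightarrow> CARD('n) = 1)
    \<and> (theta B = sqrt (real CARD('n) + 1) \<longleftrightarrow> sqrt (real CARD('n) + 1) \<in> \<int>)"
proof -
  let ?n = "CARD('n)"
  have n0: "?n > 0" by simp
  have ge: "ball_bound ?n k \<le> theta B" if "0 < k" "k \<le> ?n" for k
    unfolding B_def using that by (intro theta_cball_ge projector_norm_ge_ball_bound)
  have upper: "theta B \<le> sqrt (real ?n + 1)"
    unfolding B_def by (intro theta_cball_le ball_bound_le_sqrt(1))
  have one: "theta B = 1" if "?n = 1"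
  proof (rule antisym)
    show "1 \<le> theta B" unfolding B_def by (intro theta_cball_ge projector_norm_ge_1)
    \<comment> \<open>Here \<open>c\<close> is \<open>1\<close>, \<open>0\<close> or
      \<open>-1\<close>, with the values \<open>1\<close>, \<open>1\<close> and
      \<open>-1\<close>.\<close>
    have "ball_bound 1 k \<le> 1" if "k \<le> 1 + 1" for k
    proof -
      have "k = 0 \<or> k = 1 \<or> k = 2" using that by auto
      then show ?thesis by (auto simp: ball_bound_def)
    qed
    then show "theta B \<le> 1" unfolding B_def using that by (intro theta_cball_le) simp
  qed
  have strict: "sqrt (real ?n) < theta B" if n1: "?n \<noteq> 1"
  proof -
    have "?n \<ge> 2" using n0 n1 by linarith
    then obtain k where k: "0 < k" "k \<le> ?n" "sqrt (real ?n) < ball_bound ?n k"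
      using ball_bound_gt_sqrt by blast
    then show ?thesis using ge[of k] by linarith
  qed
  have "theta B = sqrt (real ?n + 1)" if "sqrt (real ?n + 1) \<in> \<int>"
    using ball_bound_eq_sqrt[OF n0 that] ge upper by (metis antisym)
  moreover have "sqrt (real ?n + 1) \<in> \<int>" if th: "theta B = sqrt (real ?n + 1)"
  proof -
    \<comment> \<open>The maximum over finitely many \<open>k\<close> is attained, so if
      \<open>theta B\<close> equals \<open>sqrt (n + 1)\<close>, a single \<open>ball_bound\<close>
      must reach that value.\<close>
    let ?M = "Max (ball_bound ?n ` {..?n + 1})"
    have "theta B \<le> ?M" unfolding B_def by (intro theta_cball_le Max_ge) auto
    moreover have "?M \<in> ball_bound ?n ` {..?n + 1}" by (intro Max_in) auto
    then obtain k where k: "k \<le> ?n + 1" "?M = ball_bound ?n k" by blast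
    ultimately have "ball_bound ?n k = sqrt (real ?n + 1)"
      using th ball_bound_le_sqrt(1)[OF k(1)] by linarith
    then show ?thesis by (rule ball_bound_le_sqrt(2)[OF k(1)])
  qed
  moreover have "sqrt (real ?n) \<le> theta B" using one strict by (cases "?n = 1") auto
  moreover have "theta B = sqrt (real ?n) \<longleftrightarrow> ?n = 1"
    using one strict by (cases "?n = 1") auto
  ultimately show ?thesis using upper by blast
qed

end
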